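(* Let $\Pi^{\delta}=(V,P,\delta_V)$ and $\Sigma^{\delta}=(W,S,\delta_W)$ be weighted path complexes with weight functions valued in a unitary commutative ring $R$, such that $\delta_V(i)\in R$ is invertible for all $i\in V$. Let $f^{\delta}, g^{\delta}\colon \Pi^{\delta}\to\Sigma^{\delta}$ be weighted morphisms which are (weighted) homotopic, $f^{\delta}\simeq g^{\delta}$. Then $f^{\delta}$ and $g^{\delta}$ induce chain homotopic morphisms of chain complexes of $R$-modules $$f^{\delta}_*\simeq g^{\delta}_*\colon \Omega^w_*(\Pi^\delta)\to\Omega^w_*(\Sigma^\delta),$$ and hence equal homomorphisms $H^{\mathbf w}_*(\Pi^{\delta})\to H^{\mathbf w}_*(\Sigma^{\delta})$ of weighted path homology groups.
   Context: All vertex sets are finite; $R$ is a fixed unitary commutative ring. Path complexes. A path complex $\Pi=(V,P)$ consists of a set $V$ of vertices and a set $P$ of finite sequences $(i_0\dots i_n)$, $n\ge 0$, of elements of $V$ (elementary paths, of length $n$), such that $(i)\in P$ for every $i\in V$, and if $(i_0\dots i_n)\in P$ with $n\geq 1$ then $(i_0\dots i_{n-1})\in P$ and $(i_1\dots i_n)\in P$. A morphism $f\colon(V,P)\to(W,S)$ is given by a map $f_V\colon V\to W$ such that $(f_V(i_0)\dots f_V(i_n))\in S$ for all $(i_0\dots i_n)\in P$. A weighted path complex $\Pi^\delta=(V,P,\delta_V)$ is a path complex with a function $\delta_V\colon V\to R$ (weight function). A weighted morphism $f^\delta\colon(V,P,\delta_V)\to(W,S,\delta_W)$ is a morphism $f$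 of path complexes with $\delta_W(f_V(v))=\delta_V(v)$ for all $v\in V$. Homotopy. Let $J=\{0,1\}$; identify $i\in V$ with $(i,0)\in V\times J$ and write $i'=(i,1)$. Define the path complex $\Pi^{\uparrow}=(V\times J,P^{\uparrow})$ by $P^\uparrow=P\cup P'\cup P^{\#}$, where $P'=\{(i_0'\dots i_n')\mid (i_0\dots i_n)\in P\}$ and $P^{\#}=\{(i_0\dots i_k\,i_k'\,i_{k+1}'\dots i_n')\mid (i_0\dots i_n)\in P,\ 0\le k\le n\}$. Let $i_\bullet, j_\bullet\colon\Pi\to\Pi^\uparrow$ be the morphisms induced by $v\mapsto(v,0)$ and $v\mapsto(v,1)$. For weighted $\Pi^\delta$, the complex $\Pi^\uparrow$ is weighted by $\delta_{V\times J}(v,0)=\delta_{V\times J}(v,1)=\delta_V(v)$; denote it ${\Pi^\uparrow}^\delta$. Weighted morphisms $f^\delta,g^\delta\colon\Pi^\delta\to\Sigma^\delta$ are weighted one-step homotopic if there is a weighted morphism $F\colon{\Pi^\uparrow}^\delta\to\Sigma^\delta$ with $F\circ i_\bullet=f$ and $F\circ j_\bullet=g$. They are homotopic, $f^\delta\simeq g^\delta$, if there is a sequence of weighted morphisms $f^\delta=f_0^\delta,f_1^\delta,\dots,f_n^\delta=g^\delta\colon\Pi^\delta\to\Sigma^\delta$ in which any two consecutive ones are weighted one-step homotopic. Weighted path homology. A path $(i_0\dots i_n)$ on $V$ is regular if $i_k\ne i_{k+1}$ for $0\le k\le n-1$. For $n\ge0$, $\mathcal R_n^{reg}(V)$ is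 the free $R$-module with basis $e_{i_0\dots i_n}$ over all regular paths on $V$ of length $n$, and $\mathcal R^{reg}_n(P)\subset\mathcal R^{reg}_n(V)$ is the submodule generated by the regular paths belonging to $P$; $\mathcal R^{reg}_{-1}=0$. By convention $e_{i_0\dots i_n}=0$ whenever $(i_0\dots i_n)$ is not regular. The weighted boundary $\partial^w_n\colon\mathcal R^{reg}_n(V)\to\mathcal R^{reg}_{n-1}(V)$ is $\partial_0^w=0$ and, for $n\ge1$, $\partial_n^w(e_{i_0\dots i_n})=\sum_{s=0}^n(-1)^s\delta_V(i_s)\,e_{i_0\dots\widehat{i_s}\dots i_n}$; it satisfies $(\partial^w)^2=0$. Put $\Omega^w_{-1}=0$ and $\Omega^w_n(\Pi^\delta)=\{v\in\mathcal R_n^{reg}(P)\mid\partial^wv\in\mathcal R^{reg}_{n-1}(P)\}$ for $n\ge0$. With differential $\partial^w$ this is a chain complex, and $H^{\mathbf w}_*(\Pi^\delta)$ is its homology. A weighted morphism $f^\delta$ induces a chain map $f^\delta_*$ by $e_{i_0\dots i_n}\mapsto e_{f_V(i_0)\dots f_V(i_n)}$ (zero if the image path is not regular). *)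

theory Defs
  imports Complex_Main "HOL-Library.Poly_Mapping"
begin

section \<open>Weighted path complexes and their morphisms\<close>

text \<open>The path \<open>(i\<^sub>0 \<dots> i\<^sub>n)\<close> is the list \<open>[i\<^sub>0, \<dots>, i\<^sub>n]\<close> of length \<open>n + 1\<close>.\<close>

record ('a, 'r) wpath_complex =
  verts :: "'a set"
  paths :: "'a list set"
  weight :: "'a \<Rightarrow> 'r"

definition weighted_path_complex :: "('a, 'r) wpath_complex \<Rightarrow> bool" where
  "weighted_path_complex K \<longleftrightarrow>
     finite (verts K) \<and>
     (\<forall>p \<in> paths K. p \<noteq> [] \<and> set p \<subseteq> verts K) \<and>
     (\<forall>i \<in> verts K. [i] \<in> paths K) \<and>
     (\<forall>p \<in> paths K. length p \<ge> 2 \<longrightarrow> butlast p \<in> paths K \<and> tl p \<in> paths K)"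

text \<open>A vertex map is represented by a total function of which only the values on the vertex set
  matter; two morphisms are equal if they agree on the vertex set of the source.\<close>

definition weighted_morphism ::
    "('a, 'r) wpath_complex \<Rightarrow> ('b, 'r) wpath_complex \<Rightarrow> ('a \<Rightarrow> 'b) \<Rightarrow> bool" where
  "weighted_morphism K L f \<longleftrightarrow>
     f ` verts K \<subseteq> verts L \<and>
     (\<forall>p \<in> paths K. map f p \<in> paths L) \<and>
     (\<forall>v \<in> verts K. weight L (f v) = weight K v)"

section \<open>Homotopy\<close>

definition up :: "('a, 'r) wpath_complex \<Rightarrow> ('a \<times> nat, 'r) wpath_complex" where
  "up K =
     \<lparr>verts = verts K \<times> {0, 1},
      paths = {map (\<lambda>i. (i, 0)) p | p. p \<in> paths K}
            \<union> {map (\<lambda>i. (i, 1)) p | p. p \<in> paths K}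
            \<union> {map (\<lambda>i. (i, 0)) (take (Suc k) p) @ map (\<lambda>i. (i, 1)) (drop k p) | p k.
                 p \<in> paths K \<and> k < length p},
      weight = (\<lambda>(v, j). weight K v)\<rparr>"

definition one_step_homotopic ::
    "('a, 'r) wpath_complex \<Rightarrow> ('b, 'r) wpath_complex \<Rightarrow> ('a \<Rightarrow> 'b) \<Rightarrow> ('a \<Rightarrow> 'b) \<Rightarrow> bool" where
  "one_step_homotopic K L f g \<longleftrightarrow>
     (\<exists>F. weighted_morphism (up K) L F \<and>
          (\<forall>v \<in> verts K. F (v, 0) = f v) \<and> (\<forall>v \<in> verts K. F (v, 1) = g v))"

text \<open>A one-step homotopy is directed. Consecutive members of the sequence may be joined by one
  in either direction, so that homotopy is an equivalence relation; sequences in which every step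
  is directed forwards are a special case.\<close>

definition homotopic ::
    "('a, 'r) wpath_complex \<Rightarrow> ('b, 'r) wpath_complex \<Rightarrow> ('a \<Rightarrow> 'b) \<Rightarrow> ('a \<Rightarrow> 'b) \<Rightarrow> bool" where
  "homotopic K L f g \<longleftrightarrow>
     (\<exists>(n::nat) h.
        (\<forall>v \<in> verts K. h 0 v = f v) \<and> (\<forall>v \<in> verts K. h n v = g v) \<and>
        (\<forall>k \<le> n. weighted_morphism K L (h k)) \<and>
        (\<forall>k < n. one_step_homotopic K L (h k) (h (Suc k)) \<or>
                 one_step_homotopic K L (h (Suc k)) (h k)))"

section \<open>Submodules of free modules, chain complexes and homology\<close>

text \<open>The free \<open>R\<close>-module on a set of generators is the type of finitely supported functions;
  submodules are given by their carrier sets.\<close>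

definition scale :: "'r::comm_ring_1 \<Rightarrow> ('x \<Rightarrow>\<^sub>0 'r) \<Rightarrow> ('x \<Rightarrow>\<^sub>0 'r)" where
  "scale c v = Poly_Mapping.map ((*) c) v"

lemma lookup_scale [simp]: "Poly_Mapping.lookup (scale c v) x = c * Poly_Mapping.lookup v x"
  by (simp add: scale_def Poly_Mapping.map.rep_eq when_def)

interpretation free_mod: module "scale :: 'r::comm_ring_1 \<Rightarrow> ('x \<Rightarrow>\<^sub>0 'r) \<Rightarrow> ('x \<Rightarrow>\<^sub>0 'r)"
  by unfold_locales (auto intro!: poly_mapping_eqI simp: lookup_add algebra_simps)

definition linear_extension ::
    "('x \<Rightarrow> ('y \<Rightarrow>\<^sub>0 'r)) \<Rightarrow> ('x \<Rightarrow>\<^sub>0 'r::comm_ring_1) \<Rightarrow> ('y \<Rightarrow>\<^sub>0 'r)" where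
  "linear_extension \<phi> v = (\<Sum>x \<in> Poly_Mapping.keys v. scale (Poly_Mapping.lookup v x) (\<phi> x))"

definition submodule_hom ::
    "('x \<Rightarrow>\<^sub>0 'r::comm_ring_1) set \<Rightarrow> ('y \<Rightarrow>\<^sub>0 'r) set \<Rightarrow> (('x \<Rightarrow>\<^sub>0 'r) \<Rightarrow> ('y \<Rightarrow>\<^sub>0 'r)) \<Rightarrow> bool" where
  "submodule_hom A B \<phi> \<longleftrightarrow>
     \<phi> ` A \<subseteq> B \<and>
     (\<forall>x \<in> A. \<forall>y \<in> A. \<phi> (x + y) = \<phi> x + \<phi> y) \<and>
     (\<forall>c. \<forall>x \<in> A. \<phi> (scale c x) = scale c (\<phi> x))"

text \<open>Complexes are indexed by \<open>n \<ge> 0\<close>; the module in degree \<open>-1\<close> is zero, and \<open>diff n\<close> is the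
  differential from degree \<open>n\<close> to degree \<open>n - 1\<close>.\<close>

record 'm complex_data =
  chains :: "nat \<Rightarrow> 'm set"
  diff :: "nat \<Rightarrow> 'm \<Rightarrow> 'm"

definition chain_complex :: "('x \<Rightarrow>\<^sub>0 'r::comm_ring_1) complex_data \<Rightarrow> bool" where
  "chain_complex C \<longleftrightarrow>
     (\<forall>n. free_mod.subspace (chains C n)) \<and>
     submodule_hom (chains C 0) {0} (diff C 0) \<and>
     (\<forall>n. submodule_hom (chains C (Suc n)) (chains C n) (diff C (Suc n))) \<and>
     (\<forall>n. \<forall>x \<in> chains C (Suc n). diff C n (diff C (Suc n) x) = 0)"

definition chain_map ::
    "('x \<Rightarrow>\<^sub>0 'r::comm_ring_1) complex_data \<Rightarrow> ('y \<Rightarrow>\<^sub>0 'r) complex_data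
       \<Rightarrow> (nat \<Rightarrow> ('x \<Rightarrow>\<^sub>0 'r) \<Rightarrow> ('y \<Rightarrow>\<^sub>0 'r)) \<Rightarrow> bool" where
  "chain_map C D \<phi> \<longleftrightarrow>
     chain_complex C \<and> chain_complex D \<and>
     (\<forall>n. submodule_hom (chains C n) (chains D n) (\<phi> n)) \<and>
     (\<forall>n. \<forall>x \<in> chains C (Suc n). \<phi> n (diff C (Suc n) x) = diff D (Suc n) (\<phi> (Suc n) x))"

definition chain_homotopic ::
    "('x \<Rightarrow>\<^sub>0 'r::comm_ring_1) complex_data \<Rightarrow> ('y \<Rightarrow>\<^sub>0 'r) complex_data
       \<Rightarrow> (nat \<Rightarrow> ('x \<Rightarrow>\<^sub>0 'r) \<Rightarrow> ('y \<Rightarrow>\<^sub>0 'r))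
       \<Rightarrow> (nat \<Rightarrow> ('x \<Rightarrow>\<^sub>0 'r) \<Rightarrow> ('y \<Rightarrow>\<^sub>0 'r)) \<Rightarrow> bool" where
  "chain_homotopic C D \<phi> \<psi> \<longleftrightarrow>
     chain_map C D \<phi> \<and> chain_map C D \<psi> \<and>
     (\<exists>s. (\<forall>n. submodule_hom (chains C n) (chains D (Suc n)) (s n)) \<and>
          (\<forall>n. \<forall>x \<in> chains C n.
             \<phi> n x - \<psi> n x =
               diff D (Suc n) (s n x) + (case n of 0 \<Rightarrow> 0 | Suc m \<Rightarrow> s m (diff C n x))))"

definition cycles :: "('x \<Rightarrow>\<^sub>0 'r::comm_ring_1) complex_data \<Rightarrow> nat \<Rightarrow> ('x \<Rightarrow>\<^sub>0 'r) set" where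
  "cycles C n = {z \<in> chains C n. diff C n z = 0}"

definition boundaries :: "('x \<Rightarrow>\<^sub>0 'r::comm_ring_1) complex_data \<Rightarrow> nat \<Rightarrow> ('x \<Rightarrow>\<^sub>0 'r) set" where
  "boundaries C n = diff C (Suc n) ` chains C (Suc n)"

definition homologous ::
    "('x \<Rightarrow>\<^sub>0 'r::comm_ring_1) complex_data \<Rightarrow> nat \<Rightarrow> (('x \<Rightarrow>\<^sub>0 'r) \<times> ('x \<Rightarrow>\<^sub>0 'r)) set" where
  "homologous C n = {(x, y). x \<in> cycles C n \<and> y \<in> cycles C n \<and> x - y \<in> boundaries C n}"

text \<open>The homology module is the set of homology classes with the operations induced by those on
  representatives.\<close>

definition homology :: "('x \<Rightarrow>\<^sub>0 'r::comm_ring_1) complex_data \<Rightarrow> nat \<Rightarrow> ('x \<Rightarrow>\<^sub>0 'r) set set" where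
  "homology C n = cycles C n // homologous C n"

definition homology_add ::
    "('x \<Rightarrow>\<^sub>0 'r::comm_ring_1) complex_data \<Rightarrow> nat
       \<Rightarrow> ('x \<Rightarrow>\<^sub>0 'r) set \<Rightarrow> ('x \<Rightarrow>\<^sub>0 'r) set \<Rightarrow> ('x \<Rightarrow>\<^sub>0 'r) set" where
  "homology_add C n X Y = (\<Union>x \<in> X. \<Union>y \<in> Y. homologous C n `` {x + y})"

definition homology_scale ::
    "('x \<Rightarrow>\<^sub>0 'r::comm_ring_1) complex_data \<Rightarrow> nat \<Rightarrow> 'r \<Rightarrow> ('x \<Rightarrow>\<^sub>0 'r) set \<Rightarrow> ('x \<Rightarrow>\<^sub>0 'r) set" where
  "homology_scale C n c X = (\<Union>x \<in> X. homologous C n `` {scale c x})"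

definition homology_hom ::
    "('x \<Rightarrow>\<^sub>0 'r::comm_ring_1) complex_data \<Rightarrow> ('y \<Rightarrow>\<^sub>0 'r) complex_data \<Rightarrow> nat
       \<Rightarrow> (('x \<Rightarrow>\<^sub>0 'r) set \<Rightarrow> ('y \<Rightarrow>\<^sub>0 'r) set) \<Rightarrow> bool" where
  "homology_hom C D n \<Phi> \<longleftrightarrow>
     \<Phi> ` homology C n \<subseteq> homology D n \<and>
     (\<forall>X \<in> homology C n. \<forall>Y \<in> homology C n.
        \<Phi> (homology_add C n X Y) = homology_add D n (\<Phi> X) (\<Phi> Y)) \<and>
     (\<forall>c. \<forall>X \<in> homology C n. \<Phi> (homology_scale C n c X) = homology_scale D n c (\<Phi> X))"

definition homology_map ::
    "('y \<Rightarrow>\<^sub>0 'r::comm_ring_1) complex_data \<Rightarrow> nat \<Rightarrow> (nat \<Rightarrow> ('x \<Rightarrow>\<^sub>0 'r) \<Rightarrow> ('y \<Rightarrow>\<^sub>0 'r))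
       \<Rightarrow> ('x \<Rightarrow>\<^sub>0 'r) set \<Rightarrow> ('y \<Rightarrow>\<^sub>0 'r) set" where
  "homology_map D n \<phi> X = (\<Union>x \<in> X. homologous D n `` {\<phi> n x})"

section \<open>Weighted path homology\<close>

text \<open>A path is regular if no two consecutive vertices are equal, which is \<^const>\<open>distinct_adj\<close>.
  \<open>elem p\<close> is \<open>e\<^sub>p\<close>, with the convention \<open>e\<^sub>p = 0\<close> for irregular \<open>p\<close>.\<close>

definition elem :: "'a list \<Rightarrow> ('a list \<Rightarrow>\<^sub>0 'r::comm_ring_1)" where
  "elem p = (if distinct_adj p then Poly_Mapping.single p 1 else 0)"

definition regular_chains :: "'a list set \<Rightarrow> nat \<Rightarrow> ('a list \<Rightarrow>\<^sub>0 'r::comm_ring_1) set" where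
  "regular_chains P n = free_mod.span (elem ` {p \<in> P. length p = Suc n \<and> distinct_adj p})"

text \<open>The sum for a path of length \<open>n\<close> runs over \<open>s = 0, \<dots>, n\<close>.\<close>

definition elem_boundary :: "('a \<Rightarrow> 'r::comm_ring_1) \<Rightarrow> 'a list \<Rightarrow> ('a list \<Rightarrow>\<^sub>0 'r)" where
  "elem_boundary \<delta> p =
     (if length p \<le> 1 then 0
      else \<Sum>s < length p. scale ((- 1) ^ s * \<delta> (p ! s)) (elem (take s p @ drop (Suc s) p)))"

definition weighted_boundary ::
    "('a \<Rightarrow> 'r::comm_ring_1) \<Rightarrow> ('a list \<Rightarrow>\<^sub>0 'r) \<Rightarrow> ('a list \<Rightarrow>\<^sub>0 'r)" where
  "weighted_boundary \<delta> = linear_extension (elem_boundary \<delta>)"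

definition Omega :: "('a, 'r::comm_ring_1) wpath_complex \<Rightarrow> ('a list \<Rightarrow>\<^sub>0 'r) complex_data" where
  "Omega K =
     \<lparr>chains = (\<lambda>n. {v \<in> regular_chains (paths K) n.
        weighted_boundary (weight K) v
          \<in> (case n of 0 \<Rightarrow> {0} | Suc m \<Rightarrow> regular_chains (paths K) m)}),
      diff = (\<lambda>n. weighted_boundary (weight K))\<rparr>"

definition induced :: "('a \<Rightarrow> 'b) \<Rightarrow> nat \<Rightarrow> ('a list \<Rightarrow>\<^sub>0 'r::comm_ring_1) \<Rightarrow> ('b list \<Rightarrow>\<^sub>0 'r)" where
  "induced f n = linear_extension (\<lambda>p. elem (map f p))"

end

theory Submission
  imports Defs
begin

text \<open>For a one-step homotopy \<open>f \<rightarrow> g\<close>, the prism operator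
  \<open>e\<^bsub>i\<^sub>0\<dots>i\<^sub>n\<^esub> \<mapsto> \<Sum>\<^sub>k (-1)\<^sup>k \<delta>(i\<^sub>k)\<^sup>-\<^sup>1 e\<^bsub>f i\<^sub>0\<dots>f i\<^sub>k g i\<^sub>k\<dots>g i\<^sub>n\<^esub>\<close>
  is a chain homotopy: in its boundary, deleting \<open>f i\<^sub>k\<close> or \<open>g i\<^sub>k\<close> produces the weight
  \<open>\<delta>(i\<^sub>k)\<close>, which the inverse cancels, so these terms telescope to \<open>g - f\<close>, and the remaining terms
  are minus the prism of the boundary. It preserves \<open>\<Omega>\<close> because the homotopy formula itself
  expresses the boundary of a prism by allowed paths.

  All identities are proved by induction along the operator \<open>e\<^sub>p \<mapsto> e\<^bsub>x p\<^esub>\<close>. To make the boundary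
  recursive without exception for vertices, the empty path is admitted in degree \<open>-1\<close>; the actual
  boundary arises by deleting the empty path afterwards.\<close>

section \<open>Linear extensions\<close>

text \<open>The added indices have coefficient zero. Summing over a common finite set makes the
  extensions of \<open>u\<close>, \<open>v\<close> and \<open>u + v\<close> comparable term by
  term.\<close>

lemma linear_extension_superset:
  assumes "finite A" "Poly_Mapping.keys v \<subseteq> A"
  shows "linear_extension \<phi> v = (\<Sum>x\<in>A. scale (Poly_Mapping.lookup v x) (\<phi> x))"
  unfolding linear_extension_def
  by (rule sum.mono_neutral_left) (use assms in \<open>auto simp: in_keys_iff\<close>)

lemma linear_extension_add [simp]:
  "linear_extension \<phi> (u + v) = linear_extension \<phi> u + linear_extension \<phi> v"
proof -
  let ?A = "Poly_Mapping.keys u \<union> Poly_Mapping.keys v"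
  have "Poly_Mapping.keys (u + v) \<subseteq> ?A"
    by (rule Poly_Mapping.keys_add)
  then show ?thesis
    by (simp add: linear_extension_superset[of ?A] lookup_add free_mod.scale_left_distrib
        sum.distrib)
qed

lemma linear_extension_scale [simp]:
  "linear_extension \<phi> (scale c v) = scale c (linear_extension \<phi> v)"
proof -
  have "Poly_Mapping.keys (scale c v) \<subseteq> Poly_Mapping.keys v"
    by (auto simp: in_keys_iff)
  then show ?thesis
    by (simp add: linear_extension_superset[of "Poly_Mapping.keys v"] free_mod.scale_sum_right)
qed

lemma linear_extension_0 [simp]: "linear_extension \<phi> 0 = 0"
  by (simp add: linear_extension_def)

lemma linear_extension_eq_0: "(\<And>p. \<phi> p = 0) \<Longrightarrow> linear_extension \<phi> v = 0"
  by (simp add: linear_extension_def)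

lemma linear_extension_uminus [simp]: "linear_extension \<phi> (- v) = - linear_extension \<phi> v"
  by (metis add.inverse_unique add.right_inverse linear_extension_0 linear_extension_add)

lemma linear_extension_diff [simp]:
  "linear_extension \<phi> (u - v) = linear_extension \<phi> u - linear_extension \<phi> v"
  by (metis linear_extension_add linear_extension_uminus diff_conv_add_uminus)

lemma linear_extension_sum:
  "linear_extension \<phi> (\<Sum>i\<in>I. h i) = (\<Sum>i\<in>I. linear_extension \<phi> (h i))"
  by (induction I rule: infinite_finite_induct) auto

lemma linear_extension_single [simp]: "linear_extension \<phi> (Poly_Mapping.single p 1) = \<phi> p"
  by (simp add: linear_extension_def)

lemma linear_extension_linear_extension:
  "linear_extension \<phi> (linear_extension \<psi> v) = linear_extension (\<lambda>p. linear_extension \<phi> (\<psi> p)) v"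
  by (simp add: linear_extension_def[of \<psi>] linear_extension_def[of "\<lambda>p. linear_extension \<phi> (\<psi> p)"]
      linear_extension_sum)

section \<open>Elementary paths and the operator of prefixing a vertex\<close>

lemma elem_irregular: "\<not> distinct_adj p \<Longrightarrow> elem p = 0"
  by (simp add: elem_def)

text \<open>The basis of the ambient free module consists of all lists, irregular ones included. An
  operator given on lists therefore has the expected value on \<open>elem p\<close> only if it
  respects the convention that irregular paths are zero.\<close>

lemma linear_extension_elem:
  "(\<not> distinct_adj p \<Longrightarrow> \<phi> p = 0) \<Longrightarrow> linear_extension \<phi> (elem p) = \<phi> p"
  by (simp add: elem_def)

text \<open>The regular chains of all degrees together, with the empty path in degree -1. Outside
  this span, on irregular basis lists, the recursion for the boundary can fail.\<close>

abbreviation elem_span :: "('a list \<Rightarrow>\<^sub>0 'r::comm_ring_1) set" where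
  "elem_span \<equiv> free_mod.span (range elem)"

lemma elem_in_span [simp]: "elem p \<in> elem_span"
  by (simp add: free_mod.span_base)

lemma linear_extension_in_span:
  assumes "\<And>b. b \<in> B \<Longrightarrow> linear_extension \<phi> b \<in> free_mod.span C" "v \<in> free_mod.span B"
  shows "linear_extension \<phi> v \<in> free_mod.span C"
  using assms(2)
  by (induction rule: free_mod.span_induct_alt)
    (auto simp: assms(1) free_mod.span_zero intro!: free_mod.span_add free_mod.span_scale)

abbreviation cons :: "'a \<Rightarrow> ('a list \<Rightarrow>\<^sub>0 'r::comm_ring_1) \<Rightarrow> ('a list \<Rightarrow>\<^sub>0 'r)" where
  "cons x \<equiv> linear_extension (\<lambda>p. elem (x # p))"

lemma cons_elem [simp]: "cons x (elem p) = elem (x # p)"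
  by (rule linear_extension_elem) (auto simp: elem_def dest: distinct_adj_ConsD)

lemma cons_in_span [simp]: "v \<in> elem_span \<Longrightarrow> cons x v \<in> elem_span"
  by (erule linear_extension_in_span[rotated]) auto

text \<open>A list beginning with \<open>x, x\<close> is irregular. This relation removes the
  remainder terms in the treatment of repeated vertices below.\<close>

lemma cons_cons_same [simp]: "cons x (cons x v) = 0"
  unfolding linear_extension_linear_extension
  by (rule linear_extension_eq_0) (simp add: elem_def[of "x # x # _"])

text \<open>Splitting off the first vertex shifts the index by one, which flips every sign, and puts
  \<open>x\<close> in front of every term. The boundary and the prism both get their recursion from
  this.\<close>

lemma sum_scale_cons_shift:
  "(\<Sum>k<n. scale ((- 1) ^ Suc k * c k) (elem (x # q k))) =
     - cons x (\<Sum>k<n. scale ((- 1) ^ k * c k) (elem (q k)))"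
  by (simp add: linear_extension_sum sum_negf)

section \<open>The augmented boundary\<close>

definition augmented_elem_boundary :: "('a \<Rightarrow> 'r::comm_ring_1) \<Rightarrow> 'a list \<Rightarrow> ('a list \<Rightarrow>\<^sub>0 'r)" where
  "augmented_elem_boundary \<delta> p =
     (\<Sum>s < length p. scale ((- 1) ^ s * \<delta> (p ! s)) (elem (take s p @ drop (Suc s) p)))"

abbreviation augmented_boundary ::
    "('a \<Rightarrow> 'r::comm_ring_1) \<Rightarrow> ('a list \<Rightarrow>\<^sub>0 'r) \<Rightarrow> ('a list \<Rightarrow>\<^sub>0 'r)" where
  "augmented_boundary \<delta> \<equiv> linear_extension (augmented_elem_boundary \<delta>)"

lemma augmented_elem_boundary_Nil [simp]: "augmented_elem_boundary \<delta> [] = 0"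
  by (simp add: augmented_elem_boundary_def)

lemma augmented_elem_boundary_Cons [simp]:
  "augmented_elem_boundary \<delta> (x # p) =
     scale (\<delta> x) (elem p) - cons x (augmented_elem_boundary \<delta> p)"
  unfolding augmented_elem_boundary_def
  by (simp del: power_Suc sum.lessThan_Suc add: sum.lessThan_Suc_shift sum_scale_cons_shift)

lemma augmented_elem_boundary_in_span [simp]: "augmented_elem_boundary \<delta> p \<in> elem_span"
  by (induction p) (auto intro!: free_mod.span_diff free_mod.span_scale free_mod.span_zero)

text \<open>In \<open>x, x, q\<close> the deletions of the two copies of \<open>x\<close> have equal
  weight and opposite sign, so they cancel; all other terms still contain \<open>x, x\<close>. An
  irregularity further on lies in the tail and is covered by induction.\<close>

lemma augmented_elem_boundary_irregular:
  "\<not> distinct_adj p \<Longrightarrow> augmented_elem_boundary \<delta> p = 0"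
proof (induction p)
  case (Cons x p)
  show ?case
  proof (cases "distinct_adj p")
    case True
    with Cons.prems obtain q where "p = x # q"
      by (cases p) auto
    then show ?thesis
      by simp
  qed (use Cons.IH in \<open>simp add: elem_def\<close>)
qed simp

lemma augmented_boundary_elem [simp]:
  "augmented_boundary \<delta> (elem p) = augmented_elem_boundary \<delta> p"
  by (rule linear_extension_elem) (rule augmented_elem_boundary_irregular)

lemma augmented_boundary_cons:
  "v \<in> elem_span \<Longrightarrow> augmented_boundary \<delta> (cons x v) =
     scale (\<delta> x) v - cons x (augmented_boundary \<delta> v)"
  by (induction rule: free_mod.span_induct_alt)
    (auto simp: free_mod.scale_right_distrib free_mod.scale_right_diff_distrib mult.commute)

text \<open>Applying the recursion twice to \<open>x # p\<close> gives \<open>\<delta> x\<close>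
  times the boundary of \<open>p\<close> twice with opposite signs, and the double boundary of
  \<open>p\<close> prefixed by \<open>x\<close>, which is zero by induction.\<close>

lemma augmented_boundary_augmented_elem_boundary:
  "augmented_boundary \<delta> (augmented_elem_boundary \<delta> p) = 0"
  by (induction p) (auto simp: augmented_boundary_cons)

section \<open>Removing the augmentation\<close>

abbreviation delete_Nil :: "('a list \<Rightarrow>\<^sub>0 'r::comm_ring_1) \<Rightarrow> ('a list \<Rightarrow>\<^sub>0 'r)" where
  "delete_Nil \<equiv> linear_extension (\<lambda>p. if p = [] then 0 else elem p)"

lemma delete_Nil_elem [simp]: "delete_Nil (elem p) = (if p = [] then 0 else elem p)"
  by (rule linear_extension_elem) (auto simp: elem_def)

lemma delete_Nil_cons [simp]: "delete_Nil (cons x v) = cons x v"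
  by (simp add: linear_extension_linear_extension)

text \<open>Only a single vertex has the empty path as a face, and it has no other; for longer paths
  the two sums agree.\<close>

lemma elem_boundary_eq: "elem_boundary \<delta> p = delete_Nil (augmented_elem_boundary \<delta> p)"
proof (cases "length p \<le> 1")
  case True
  then show ?thesis
    by (cases p) (auto simp: elem_boundary_def)
next
  case False
  then show ?thesis
    by (auto simp: elem_boundary_def augmented_elem_boundary_def linear_extension_sum intro!: sum.cong)
qed

lemma weighted_boundary_eq: "weighted_boundary \<delta> v = delete_Nil (augmented_boundary \<delta> v)"
  by (simp add: weighted_boundary_def linear_extension_linear_extension flip: elem_boundary_eq)

text \<open>\<open>delete_Nil\<close> alters a vector only in its coefficients at the empty path and
  at irregular lists, where \<open>\<phi>\<close> vanishes. Both the augmented boundary and the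
  prism are of this kind.\<close>

lemma linear_extension_delete_Nil:
  assumes "\<phi> [] = 0" "\<And>p. \<not> distinct_adj p \<Longrightarrow> \<phi> p = 0"
  shows "linear_extension \<phi> (delete_Nil v) = linear_extension \<phi> v"
proof -
  have "(\<lambda>p. linear_extension \<phi> (if p = [] then 0 else elem p)) = \<phi>"
    using assms by (auto simp: linear_extension_elem)
  then show ?thesis
    by (simp add: linear_extension_linear_extension)
qed

lemma weighted_boundary_weighted_boundary [simp]:
  "weighted_boundary \<delta> (weighted_boundary \<delta> v) = 0"
proof -
  have "augmented_boundary \<delta> (augmented_boundary \<delta> v) = 0"
    by (subst linear_extension_linear_extension, rule linear_extension_eq_0)
      (rule augmented_boundary_augmented_elem_boundary)
  then show ?thesis
    by (simp add: weighted_boundary_eq augmented_elem_boundary_irregular linear_extension_delete_Nil)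
qed

section \<open>Maps of chains induced by vertex maps\<close>

lemma induced_elem [simp]: "induced f n (elem p) = elem (map f p)"
  unfolding induced_def
  by (rule linear_extension_elem) (auto simp: elem_def dest: distinct_adj_mapD)

lemma induced_linear [simp]:
  "induced f n 0 = 0"
  "induced f n (u + v) = induced f n u + induced f n v"
  "induced f n (u - v) = induced f n u - induced f n v"
  "induced f n (scale c v) = scale c (induced f n v)"
  by (simp_all add: induced_def)

lemma induced_cons:
  "v \<in> elem_span \<Longrightarrow> induced f n (cons x v) = cons (f x) (induced f n v)"
  by (induction rule: free_mod.span_induct_alt) auto

text \<open>The recursion is natural: \<open>f\<close> turns prefixing by \<open>x\<close> into
  prefixing by \<open>f x\<close>, and the weights agree. A regular path with irregular image is
  included, both sides then being zero.\<close>

lemma induced_augmented_elem_boundary: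
  assumes "\<And>x. x \<in> set p \<Longrightarrow> \<epsilon> (f x) = \<delta> x"
  shows "induced f n (augmented_elem_boundary \<delta> p) = augmented_elem_boundary \<epsilon> (map f p)"
  using assms by (induction p) (auto simp: induced_cons)

lemma delete_Nil_induced: "delete_Nil (induced f n v) = induced f n (delete_Nil v)"
  unfolding induced_def linear_extension_linear_extension
proof (rule arg_cong[where f = "\<lambda>\<phi>. linear_extension \<phi> v"], rule ext)
  fix p
  show "delete_Nil (elem (map f p)) =
      linear_extension (\<lambda>p. elem (map f p)) (if p = [] then 0 else elem p)"
    by (simp add: induced_elem[unfolded induced_def])
qed

section \<open>The prism operator\<close>

text \<open>The function \<open>a\<close> stands for the inverse of the weight, a property imposed
  later and only at the vertices concerned. \<open>take (Suc k) p\<close> and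
  \<open>drop k p\<close> overlap in \<open>p ! k\<close>, which thus occurs once under
  \<open>f\<close> and once under \<open>g\<close>.\<close>

definition prism_elem ::
    "('a \<Rightarrow> 'b) \<Rightarrow> ('a \<Rightarrow> 'b) \<Rightarrow> ('a \<Rightarrow> 'r::comm_ring_1) \<Rightarrow> 'a list \<Rightarrow> ('b list \<Rightarrow>\<^sub>0 'r)" where
  "prism_elem f g a p =
     (\<Sum>k < length p. scale ((- 1) ^ k * a (p ! k))
        (elem (map f (take (Suc k) p) @ map g (drop k p))))"

abbreviation prism ::
    "('a \<Rightarrow> 'b) \<Rightarrow> ('a \<Rightarrow> 'b) \<Rightarrow> ('a \<Rightarrow> 'r::comm_ring_1)
       \<Rightarrow> ('a list \<Rightarrow>\<^sub>0 'r) \<Rightarrow> ('b list \<Rightarrow>\<^sub>0 'r)" where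
  "prism f g a \<equiv> linear_extension (prism_elem f g a)"

lemma prism_elem_Nil [simp]: "prism_elem f g a [] = 0"
  by (simp add: prism_elem_def)

lemma prism_elem_Cons [simp]:
  "prism_elem f g a (x # p) =
     scale (a x) (elem (f x # g x # map g p)) - cons (f x) (prism_elem f g a p)"
  unfolding prism_elem_def
  by (simp del: power_Suc sum.lessThan_Suc add: sum.lessThan_Suc_shift sum_scale_cons_shift)

lemma prism_elem_in_span [simp]: "prism_elem f g a p \<in> elem_span"
  by (induction p) (auto intro!: free_mod.span_diff free_mod.span_scale free_mod.span_zero)

text \<open>Here nothing has to cancel: each term of the prism over \<open>x, x, q\<close> repeats
  \<open>f x\<close> or \<open>g x\<close>, or inherits the repetition, and is itself zero.\<close>

lemma prism_elem_irregular: "\<not> distinct_adj p \<Longrightarrow> prism_elem f g a p = 0"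
proof (induction p)
  case (Cons x p)
  show ?case
  proof (cases "distinct_adj p")
    case True
    with Cons.prems obtain q where "p = x # q"
      by (cases p) auto
    then show ?thesis
      by (simp add: elem_irregular)
  next
    case False
    then have "\<not> distinct_adj (f x # g x # map g p)"
      by (metis distinct_adj_ConsD distinct_adj_mapD)
    then show ?thesis
      using Cons.IH False by (simp add: elem_irregular)
  qed
qed simp

lemma prism_elem_eq [simp]: "prism f g a (elem p) = prism_elem f g a p"
  by (rule linear_extension_elem) (rule prism_elem_irregular)

lemma prism_cons:
  "v \<in> elem_span \<Longrightarrow>
     prism f g a (cons x v) =
       scale (a x) (cons (f x) (cons (g x) (induced g n v))) - cons (f x) (prism f g a v)"
  by (induction rule: free_mod.span_induct_alt)
    (auto simp: free_mod.scale_right_distrib free_mod.scale_right_diff_distrib mult.commute)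

lemma delete_Nil_prism: "delete_Nil (prism f g a v) = prism f g a v"
proof -
  have "delete_Nil (prism_elem f g a p) = prism_elem f g a p" for p
    by (cases p) auto
  then show ?thesis
    by (simp add: linear_extension_linear_extension[of _ "prism_elem f g a"])
qed

text \<open>For \<open>x # p\<close>, the multiples by \<open>\<delta> x\<close> of the prism of
  \<open>p\<close> cancel, and so do the terms with \<open>f x, g x\<close> in front of the boundary
  of \<open>map g p\<close>. As \<open>a x * \<delta> x = 1\<close>, there remains
  \<open>g x, map g p\<close> minus \<open>f x, map g p\<close>, plus the induction hypothesis
  prefixed by \<open>f x\<close>, which turns \<open>f x, map g p\<close> into
  \<open>f x, map f p\<close>.\<close>

lemma augmented_prism:
  assumes "\<And>x. x \<in> set p \<Longrightarrow> \<epsilon> (f x) = \<delta> x" "\<And>x. x \<in> set p \<Longrightarrow> \<epsilon> (g x) = \<delta> x"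
    and "\<And>x. x \<in> set p \<Longrightarrow> \<delta> x * a x = 1"
  shows "augmented_boundary \<epsilon> (prism_elem f g a p) + prism f g a (augmented_elem_boundary \<delta> p) =
           elem (map g p) - elem (map f p)"
  using assms
proof (induction p)
  case (Cons x p)
  have g: "induced g n (augmented_elem_boundary \<delta> p) = augmented_elem_boundary \<epsilon> (map g p)" for n
    using Cons.prems by (intro induced_augmented_elem_boundary) auto
  \<comment> \<open>Solved for the prism of the boundary, the hypothesis becomes a rewrite rule for
    the term that \<open>prism_cons\<close> leaves.\<close>
  have IH: "prism f g a (augmented_elem_boundary \<delta> p) =
      elem (map g p) - elem (map f p) - augmented_boundary \<epsilon> (prism_elem f g a p)"
    using Cons by (simp add: algebra_simps)
  have "a x * \<delta> x = 1"
    using Cons.prems by (simp add: mult.commute)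
  then show ?case
    using Cons.prems
    by (simp add: augmented_boundary_cons prism_cons[where n = 0] g IH
        free_mod.scale_right_diff_distrib)
qed simp

section \<open>Allowed chains\<close>

lemma elem_in_regular_chains: "p \<in> P \<Longrightarrow> length p = Suc n \<Longrightarrow> elem p \<in> regular_chains P n"
  unfolding regular_chains_def
  by (cases "distinct_adj p") (auto intro: free_mod.span_base simp: elem_irregular free_mod.span_zero)

lemma regular_chains_induct [consumes 1, case_names zero step]:
  assumes "v \<in> regular_chains P n" "Q 0"
    and "\<And>c p v. p \<in> P \<Longrightarrow> length p = Suc n \<Longrightarrow> Q v \<Longrightarrow> Q (scale c (elem p) + v)"
  shows "Q v"
  using assms(1) unfolding regular_chains_def
  by (induction rule: free_mod.span_induct_alt) (use assms(2,3) in auto)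

lemma subspace_regular_chains [simp]: "free_mod.subspace (regular_chains P n)"
  by (simp add: regular_chains_def)

lemma linear_extension_in_regular_chains:
  assumes "\<And>p. p \<in> P \<Longrightarrow> length p = Suc n \<Longrightarrow> linear_extension \<phi> (elem p) \<in> regular_chains S m"
    and "v \<in> regular_chains P n"
  shows "linear_extension \<phi> v \<in> regular_chains S m"
  using assms(2)
  by (induction rule: regular_chains_induct)
    (auto simp: assms(1) intro!: free_mod.subspace_add free_mod.subspace_scale free_mod.subspace_0)

lemma induced_in_regular_chains:
  assumes "weighted_morphism K L f" "v \<in> regular_chains (paths K) n"
  shows "induced f m v \<in> regular_chains (paths L) n"
  unfolding induced_def
proof (rule linear_extension_in_regular_chains[OF _ assms(2)])
  fix p assume "p \<in> paths K" "length p = Suc n"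
  with assms(1) show "linear_extension (\<lambda>p. elem (map f p)) (elem p) \<in> regular_chains (paths L) n"
    by (auto simp: induced_elem[unfolded induced_def] weighted_morphism_def
        intro!: elem_in_regular_chains)
qed

text \<open>The first hypothesis is what a one-step homotopy supplies, by mapping the mixed paths of
  \<open>up K\<close>.\<close>

lemma prism_in_regular_chains:
  assumes "\<And>p k. p \<in> P \<Longrightarrow> k < length p \<Longrightarrow> map f (take (Suc k) p) @ map g (drop k p) \<in> S"
    and "v \<in> regular_chains P n"
  shows "prism f g a v \<in> regular_chains S (Suc n)"
proof (rule linear_extension_in_regular_chains[OF _ assms(2)])
  fix p assume "p \<in> P" "length p = Suc n"
  then show "prism f g a (elem p) \<in> regular_chains S (Suc n)"
    unfolding prism_elem_eq prism_elem_def
    by (intro free_mod.subspace_sum[OF subspace_regular_chains]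
        free_mod.subspace_scale[OF subspace_regular_chains] elem_in_regular_chains assms(1)) auto
qed

section \<open>Boundary formulas on allowed chains\<close>

lemma weighted_boundary_linear [simp]:
  "weighted_boundary \<delta> 0 = 0"
  "weighted_boundary \<delta> (u + v) = weighted_boundary \<delta> u + weighted_boundary \<delta> v"
  "weighted_boundary \<delta> (u - v) = weighted_boundary \<delta> u - weighted_boundary \<delta> v"
  "weighted_boundary \<delta> (scale c v) = scale c (weighted_boundary \<delta> v)"
  by (simp_all add: weighted_boundary_def)

lemma weighted_boundary_elem:
  "weighted_boundary \<delta> (elem p) = delete_Nil (augmented_elem_boundary \<delta> p)"
  by (simp add: weighted_boundary_eq)

lemma weighted_boundary_induced:
  assumes "\<And>p. p \<in> P \<Longrightarrow> set p \<subseteq> V" "\<And>x. x \<in> V \<Longrightarrow> \<epsilon> (f x) = \<delta> x"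
    and "v \<in> regular_chains P n"
  shows "weighted_boundary \<epsilon> (induced f k v) = induced f m (weighted_boundary \<delta> v)"
  using assms(3)
proof (induction rule: regular_chains_induct)
  case (step c p v)
  have "induced f m (augmented_elem_boundary \<delta> p) = augmented_elem_boundary \<epsilon> (map f p)"
    using assms(1)[OF step(1)] by (intro induced_augmented_elem_boundary) (auto intro: assms(2))
  with step show ?case
    by (simp add: weighted_boundary_elem flip: delete_Nil_induced)
qed simp

lemma weighted_boundary_prism:
  assumes "\<And>p. p \<in> P \<Longrightarrow> set p \<subseteq> V" "\<And>x. x \<in> V \<Longrightarrow> \<epsilon> (f x) = \<delta> x"
    and "\<And>x. x \<in> V \<Longrightarrow> \<epsilon> (g x) = \<delta> x" "\<And>x. x \<in> V \<Longrightarrow> \<delta> x * a x = 1"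
    and "v \<in> regular_chains P n"
  shows "weighted_boundary \<epsilon> (prism f g a v) + prism f g a (weighted_boundary \<delta> v) =
           induced g n v - induced f n v"
  using assms(5)
proof (induction rule: regular_chains_induct)
  case (step c p v)
  have "delete_Nil (augmented_boundary \<epsilon> (prism_elem f g a p) +
        prism f g a (augmented_elem_boundary \<delta> p)) =
      delete_Nil (elem (map g p) - elem (map f p))"
    using assms(1)[OF step(1)] by (subst augmented_prism) (auto intro: assms(2-4))
  \<comment> \<open>The boundary of a vertex may contribute an empty path, but the prism over the
    empty path is zero.\<close>
  moreover have "prism f g a (delete_Nil (augmented_elem_boundary \<delta> p)) =
      prism f g a (augmented_elem_boundary \<delta> p)"
    by (intro linear_extension_delete_Nil) (auto intro: prism_elem_irregular)
  \<comment> \<open>The length of \<open>p\<close> is positive, so \<open>delete_Nil\<close> leaves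
    the right-hand side unchanged.\<close>
  ultimately have "weighted_boundary \<epsilon> (prism_elem f g a p) +
      prism f g a (weighted_boundary \<delta> (elem p)) =
      elem (map g p) - elem (map f p)"
    using step(2) by (auto simp: weighted_boundary_eq delete_Nil_prism)
  then have "scale c (weighted_boundary \<epsilon> (prism_elem f g a p)) +
      scale c (prism f g a (weighted_boundary \<delta> (elem p))) =
      scale c (elem (map g p)) - scale c (elem (map f p))"
    by (metis free_mod.scale_right_distrib free_mod.scale_right_diff_distrib)
  with step(3) show ?case
    by (simp add: algebra_simps)
qed simp

section \<open>The complex \<open>Omega K\<close> and the effect of one-step homotopies\<close>

lemma chains_Omega:
  "v \<in> chains (Omega K) n \<longleftrightarrow> v \<in> regular_chains (paths K) n \<and>
     weighted_boundary (weight K) v \<in> (case n of 0 \<Rightarrow> {0} | Suc m \<Rightarrow> regular_chains (paths K) m)"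
  by (simp add: Omega_def)

lemma diff_Omega [simp]: "diff (Omega K) n = weighted_boundary (weight K)"
  by (simp add: Omega_def)

lemma subspace_chains_Omega: "free_mod.subspace (chains (Omega K) n)"
proof -
  have "free_mod.subspace (case n of 0 \<Rightarrow> {0} | Suc m \<Rightarrow> regular_chains (paths K) m)"
    by (cases n) auto
  then show ?thesis
    by (intro free_mod.subspaceI)
      (auto simp: chains_Omega intro: free_mod.subspace_0 free_mod.subspace_add free_mod.subspace_scale)
qed

text \<open>The boundary of a member is allowed by definition, and the boundary of that is zero,
  hence allowed as well.\<close>

lemma chain_complex_Omega: "chain_complex (Omega K)"
  unfolding chain_complex_def submodule_hom_def
  by (auto simp: subspace_chains_Omega chains_Omega free_mod.subspace_0 split: nat.split)

lemma chain_map_induced: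
  assumes K: "weighted_path_complex K" and f: "weighted_morphism K L f"
  shows "chain_map (Omega K) (Omega L) (induced f)"
proof -
  have comm: "weighted_boundary (weight L) (induced f k v) =
      induced f m (weighted_boundary (weight K) v)"
    if "v \<in> regular_chains (paths K) n" for k m n v
    using that K f
    by (intro weighted_boundary_induced[of _ "verts K"])
      (auto simp: weighted_path_complex_def weighted_morphism_def)
  have "induced f n v \<in> chains (Omega L) n" if "v \<in> chains (Omega K) n" for n v
    using that comm[of v n n n]
    by (cases n) (auto simp: chains_Omega intro!: induced_in_regular_chains[OF f])
  then show ?thesis
    by (auto simp: chain_map_def chain_complex_Omega submodule_hom_def chains_Omega
        intro!: comm[symmetric])
qed

text \<open>The prism formula yields \<open>g\<close> minus \<open>f\<close>, hence the order of the
  two maps in the conclusion.\<close>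

lemma chain_homotopic_if_one_step:
  assumes K: "weighted_path_complex K" and inv: "\<forall>i \<in> verts K. weight K i dvd 1"
    and f: "weighted_morphism K L f" and g: "weighted_morphism K L g"
    and hom: "one_step_homotopic K L f g"
  shows "chain_homotopic (Omega K) (Omega L) (induced g) (induced f)"
proof -
  obtain F where F: "weighted_morphism (up K) L F"
    "\<And>v. v \<in> verts K \<Longrightarrow> F (v, 0) = f v" "\<And>v. v \<in> verts K \<Longrightarrow> F (v, 1) = g v"
    using hom unfolding one_step_homotopic_def by blast
  \<comment> \<open>An inverse of the weight at each vertex of \<open>K\<close>; elsewhere the
    chosen value is arbitrary.\<close>
  define a where "a x = (SOME c. weight K x * c = 1)" for x
  have a: "weight K x * a x = 1" if "x \<in> verts K" for x
    unfolding a_def by (rule someI_ex) (use inv that in \<open>metis dvdE\<close>)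
  have sub: "set p \<subseteq> verts K" if "p \<in> paths K" for p
    using that K by (auto simp: weighted_path_complex_def)
  have "map f (take (Suc k) p) @ map g (drop k p) \<in> paths L" if "p \<in> paths K" "k < length p" for p k
  proof -
    \<comment> \<open>The mixed path over \<open>p\<close> in the cylinder that passes from level 0
      to level 1 at \<open>p ! k\<close>.\<close>
    let ?q = "map (\<lambda>i. (i, 0)) (take (Suc k) p) @ map (\<lambda>i. (i, 1)) (drop k p)"
    have "?q \<in> paths (up K)"
      using that by (auto simp: up_def)
    with F(1) have "map F ?q \<in> paths L"
      unfolding weighted_morphism_def by blast
    moreover have "map F ?q = map f (take (Suc k) p) @ map g (drop k p)"
      using sub[OF that(1)] set_take_subset[of "Suc k" p] set_drop_subset[of k p]
      by (auto simp: F(2,3)[simplified] subset_iff)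
    ultimately show ?thesis
      by (simp only:)
  qed
  then have reg: "prism f g a v \<in> regular_chains (paths L) (Suc n)"
    if "v \<in> regular_chains (paths K) n" for v n
    using that by (rule prism_in_regular_chains)
  have eq: "weighted_boundary (weight L) (prism f g a v) +
      prism f g a (weighted_boundary (weight K) v) =
      induced g n v - induced f n v" if "v \<in> regular_chains (paths K) n" for v n
    using sub f g a that
    by (intro weighted_boundary_prism[of _ "verts K"]) (auto simp: weighted_morphism_def)
  have "prism f g a v \<in> chains (Omega L) (Suc n)" if v: "v \<in> chains (Omega K) n" for v n
  proof -
    \<comment> \<open>In degree 0 the boundary of \<open>v\<close> is zero; in positive degree it is
      allowed, and the prism restores the degree \<open>n\<close>.\<close>
    have "prism f g a (weighted_boundary (weight K) v) \<in> regular_chains (paths L) n"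
      using v by (cases n) (auto simp: chains_Omega reg free_mod.subspace_0)
    moreover have "weighted_boundary (weight L) (prism f g a v) =
        induced g n v - induced f n v - prism f g a (weighted_boundary (weight K) v)"
      using eq v by (simp add: chains_Omega eq_diff_eq)
    ultimately show ?thesis
      using v by (auto simp: chains_Omega reg
          intro!: free_mod.subspace_diff induced_in_regular_chains[OF f] induced_in_regular_chains[OF g])
  qed
  moreover have "induced g n v - induced f n v = diff (Omega L) (Suc n) (prism f g a v) +
      (case n of 0 \<Rightarrow> 0 | Suc m \<Rightarrow> prism f g a (diff (Omega K) n v))"
    if v: "v \<in> chains (Omega K) n" for v n
    using v eq[of v n] by (cases n) (auto simp: chains_Omega)
  ultimately show ?thesis
    unfolding chain_homotopic_def
    by (intro conjI chain_map_induced[OF K] f g exI[of _ "\<lambda>_. prism f g a"])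
      (auto simp: submodule_hom_def)
qed

section \<open>Chain homotopies\<close>

text \<open>The zero homotopy suffices. This serves the two ends of a sequence of morphisms, which
  agree with \<open>f\<close> and \<open>g\<close> on vertices only.\<close>

lemma chain_homotopic_if_eq:
  assumes "chain_map C D \<phi>" "chain_map C D \<psi>" "\<And>n x. x \<in> chains C n \<Longrightarrow> \<phi> n x = \<psi> n x"
  shows "chain_homotopic C D \<phi> \<psi>"
proof -
  have "submodule_hom (chains C n) (chains D (Suc n)) (\<lambda>_. 0)" for n
    using assms(1) by (auto simp: chain_map_def chain_complex_def submodule_hom_def free_mod.subspace_0)
  moreover have "diff D (Suc n) 0 = 0" for n
  proof -
    have "submodule_hom (chains D (Suc n)) (chains D n) (diff D (Suc n))" "0 \<in> chains D (Suc n)"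
      using assms(1) by (auto simp: chain_map_def chain_complex_def free_mod.subspace_0)
    then show ?thesis
      unfolding submodule_hom_def by (metis free_mod.scale_zero_left)
  qed
  ultimately show ?thesis
    using assms unfolding chain_homotopic_def
    by (intro conjI exI[of _ "\<lambda>_ _. 0"]) (auto split: nat.split)
qed

lemma submodule_hom_uminus:
  assumes "submodule_hom A B \<phi>" "x \<in> A"
  shows "\<phi> (- x) = - \<phi> x"
  using assms free_mod.scale_minus_left[of 1] unfolding submodule_hom_def
  by (metis free_mod.scale_one)

text \<open>Negate the homotopy. This allows for steps of a homotopy directed either way.\<close>

lemma chain_homotopic_sym:
  assumes "chain_homotopic C D \<phi> \<psi>"
  shows "chain_homotopic C D \<psi> \<phi>"
proof -
  obtain s where s: "\<And>n. submodule_hom (chains C n) (chains D (Suc n)) (s n)"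
    and eq: "\<And>n x. x \<in> chains C n \<Longrightarrow>
      \<phi> n x - \<psi> n x = diff D (Suc n) (s n x) + (case n of 0 \<Rightarrow> 0 | Suc m \<Rightarrow> s m (diff C n x))"
    and maps: "chain_map C D \<phi>" "chain_map C D \<psi>"
    using assms unfolding chain_homotopic_def by blast
  have D: "free_mod.subspace (chains D n)"
    "submodule_hom (chains D (Suc n)) (chains D n) (diff D (Suc n))" for n
    using maps by (auto simp: chain_map_def chain_complex_def)
  have "submodule_hom (chains C n) (chains D (Suc n)) (\<lambda>x. - s n x)" for n
    using s[of n] D(1) by (auto simp: submodule_hom_def free_mod.subspace_neg)
  moreover have "\<psi> n x - \<phi> n x =
      diff D (Suc n) (- s n x) + (case n of 0 \<Rightarrow> 0 | Suc m \<Rightarrow> - s m (diff C n x))"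
    if x: "x \<in> chains C n" for n x
  proof -
    have "s n x \<in> chains D (Suc n)"
      using s[of n] x by (auto simp: submodule_hom_def)
    then have "diff D (Suc n) (- s n x) = - diff D (Suc n) (s n x)"
      by (rule submodule_hom_uminus[OF D(2)])
    moreover have "\<psi> n x - \<phi> n x = - (\<phi> n x - \<psi> n x)"
      by simp
    ultimately show ?thesis
      using eq[OF x] by (auto split: nat.split)
  qed
  ultimately show ?thesis
    unfolding chain_homotopic_def using maps by (intro conjI exI[of _ "\<lambda>n x. - s n x"]) auto
qed

text \<open>Add the two homotopies.\<close>

lemma chain_homotopic_trans:
  assumes "chain_homotopic C D \<phi> \<psi>" "chain_homotopic C D \<psi> \<chi>"
  shows "chain_homotopic C D \<phi> \<chi>"
proof -
  obtain s where s: "\<And>n. submodule_hom (chains C n) (chains D (Suc n)) (s n)"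
    and s_eq: "\<And>n x. x \<in> chains C n \<Longrightarrow>
      \<phi> n x - \<psi> n x = diff D (Suc n) (s n x) + (case n of 0 \<Rightarrow> 0 | Suc m \<Rightarrow> s m (diff C n x))"
    using assms(1) unfolding chain_homotopic_def by blast
  obtain t where t: "\<And>n. submodule_hom (chains C n) (chains D (Suc n)) (t n)"
    and t_eq: "\<And>n x. x \<in> chains C n \<Longrightarrow>
      \<psi> n x - \<chi> n x = diff D (Suc n) (t n x) + (case n of 0 \<Rightarrow> 0 | Suc m \<Rightarrow> t m (diff C n x))"
    using assms(2) unfolding chain_homotopic_def by blast
  have maps: "chain_map C D \<phi>" "chain_map C D \<chi>"
    using assms by (auto simp: chain_homotopic_def)
  have D: "free_mod.subspace (chains D n)"
    "submodule_hom (chains D (Suc n)) (chains D n) (diff D (Suc n))" for n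
    using maps by (auto simp: chain_map_def chain_complex_def)
  have "submodule_hom (chains C n) (chains D (Suc n)) (\<lambda>x. s n x + t n x)" for n
    using s[of n] t[of n] D(1)
    by (auto simp: submodule_hom_def free_mod.scale_right_distrib add.assoc add.left_commute
        intro!: free_mod.subspace_add)
  moreover have "\<phi> n x - \<chi> n x = diff D (Suc n) (s n x + t n x) +
      (case n of 0 \<Rightarrow> 0 | Suc m \<Rightarrow> s m (diff C n x) + t m (diff C n x))"
    if x: "x \<in> chains C n" for n x
  proof -
    have "s n x \<in> chains D (Suc n)" "t n x \<in> chains D (Suc n)"
      using s[of n] t[of n] x by (auto simp: submodule_hom_def)
    then have "diff D (Suc n) (s n x + t n x) = diff D (Suc n) (s n x) + diff D (Suc n) (t n x)"
      using D(2)[of n] by (simp add: submodule_hom_def)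
    moreover have "\<phi> n x - \<chi> n x = (\<phi> n x - \<psi> n x) + (\<psi> n x - \<chi> n x)"
      by simp
    ultimately show ?thesis
      using s_eq[OF x] t_eq[OF x] by (auto split: nat.split)
  qed
  ultimately show ?thesis
    unfolding chain_homotopic_def using maps by (intro conjI exI[of _ "\<lambda>n x. s n x + t n x"]) auto
qed

section \<open>Induced chain maps of homotopic morphisms\<close>

lemma induced_cong:
  assumes "\<And>p. p \<in> P \<Longrightarrow> set p \<subseteq> V" "\<And>x. x \<in> V \<Longrightarrow> f x = g x" "v \<in> regular_chains P n"
  shows "induced f m v = induced g m v"
  using assms(3)
proof (induction rule: regular_chains_induct)
  case (step c p v)
  have "map f p = map g p"
    using assms(1)[OF step(1)] assms(2) by auto
  then show ?case
    by (simp only: induced_linear induced_elem step(3))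
qed simp

lemma chain_homotopic_if_homotopic:
  assumes K: "weighted_path_complex K" and inv: "\<forall>i \<in> verts K. weight K i dvd 1"
    and f: "weighted_morphism K L f" and g: "weighted_morphism K L g" and hom: "homotopic K L f g"
  shows "chain_homotopic (Omega K) (Omega L) (induced f) (induced g)"
proof -
  obtain n :: nat and h where h0: "\<forall>v \<in> verts K. h 0 v = f v" and hn: "\<forall>v \<in> verts K. h n v = g v"
    and h: "\<forall>k \<le> n. weighted_morphism K L (h k)"
    and steps: "\<forall>k < n. one_step_homotopic K L (h k) (h (Suc k)) \<or>
      one_step_homotopic K L (h (Suc k)) (h k)"
    using hom unfolding homotopic_def by blast
  have eq: "chain_homotopic (Omega K) (Omega L) (induced u) (induced v)"
    if "weighted_morphism K L u" "weighted_morphism K L v" "\<forall>x \<in> verts K. u x = v x" for u v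
  proof (rule chain_homotopic_if_eq[OF chain_map_induced chain_map_induced])
    fix m x
    assume "x \<in> chains (Omega K) m"
    then show "induced u m x = induced v m x"
      using that(3) K
      by (intro induced_cong[of "paths K" "verts K"]) (auto simp: chains_Omega weighted_path_complex_def)
  qed (use K that in auto)
  have "chain_homotopic (Omega K) (Omega L) (induced f) (induced (h k))" if "k \<le> n" for k
    using that
  proof (induction k)
    case 0
    show ?case
      by (rule eq) (use f h h0 in auto)
  next
    case (Suc k)
    \<comment> \<open>The step may be directed either way, and symmetry reduces both cases to the
      prism.\<close>
    have "chain_homotopic (Omega K) (Omega L) (induced (h k)) (induced (h (Suc k)))"
      using chain_homotopic_if_one_step[OF K inv] chain_homotopic_sym h steps Suc.prems
      by (metis Suc_le_lessD Suc_leD)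
    with Suc show ?case
      by (metis Suc_leD chain_homotopic_trans)
  qed
  moreover have "chain_homotopic (Omega K) (Omega L) (induced (h n)) (induced g)"
    by (rule eq) (use g h hn in auto)
  ultimately show ?thesis
    using chain_homotopic_trans by blast
qed

section \<open>Homology\<close>

lemma submodule_hom_0: "submodule_hom A B \<phi> \<Longrightarrow> 0 \<in> A \<Longrightarrow> \<phi> 0 = 0"
  unfolding submodule_hom_def by (metis free_mod.scale_zero_left)

lemma submodule_hom_diff:
  assumes "free_mod.subspace A" "submodule_hom A B \<phi>" "x \<in> A" "y \<in> A"
  shows "\<phi> (x - y) = \<phi> x - \<phi> y"
proof -
  have "\<phi> (x + - y) = \<phi> x + \<phi> (- y)"
    using assms(2,3) free_mod.subspace_neg[OF assms(1,4)] unfolding submodule_hom_def by blast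
  then show ?thesis
    using submodule_hom_uminus[OF assms(2,4)] by simp
qed

section \<open>Cycles, boundaries and homology classes\<close>

lemma subspace_cycles:
  assumes "chain_complex C"
  shows "free_mod.subspace (cycles C n)"
proof -
  \<comment> \<open>The differential maps into \<open>{0}\<close> in degree 0 and into the chains
    one degree lower otherwise; the existential covers both.\<close>
  have "free_mod.subspace (chains C n)" "\<exists>B. submodule_hom (chains C n) B (diff C n)"
    using assms by (cases n; auto simp: chain_complex_def)+
  then show ?thesis
    unfolding cycles_def
    by (intro free_mod.subspaceI)
      (auto simp: free_mod.subspace_0 free_mod.subspace_add free_mod.subspace_scale submodule_hom_0,
       auto simp: submodule_hom_def)
qed

lemma subspace_boundaries:
  assumes "chain_complex C"
  shows "free_mod.subspace (boundaries C n)"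
proof -
  have C: "free_mod.subspace (chains C (Suc n))"
    "submodule_hom (chains C (Suc n)) (chains C n) (diff C (Suc n))"
    using assms by (auto simp: chain_complex_def)
  show ?thesis
    unfolding boundaries_def
  proof (rule free_mod.subspaceI)
    let ?d = "diff C (Suc n)"
    show "0 \<in> ?d ` chains C (Suc n)"
      using C by (intro image_eqI[of _ _ 0]) (simp_all add: submodule_hom_0 free_mod.subspace_0)
    show "x + y \<in> ?d ` chains C (Suc n)"
      if x: "x \<in> ?d ` chains C (Suc n)" and y: "y \<in> ?d ` chains C (Suc n)" for x y
    proof -
      obtain u v where "x = ?d u" "u \<in> chains C (Suc n)" "y = ?d v" "v \<in> chains C (Suc n)"
        using x y by blast
      then show ?thesis
        using C by (intro image_eqI[of _ _ "u + v"])
          (simp_all add: submodule_hom_def free_mod.subspace_add)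
    qed
    show "scale c x \<in> ?d ` chains C (Suc n)" if x: "x \<in> ?d ` chains C (Suc n)" for c x
    proof -
      obtain u where "x = ?d u" "u \<in> chains C (Suc n)"
        using x by blast
      then show ?thesis
        using C by (intro image_eqI[of _ _ "scale c u"])
          (simp_all add: submodule_hom_def free_mod.subspace_scale)
    qed
  qed
qed

text \<open>Reflexivity, symmetry and transitivity are the closure of the boundaries under zero,
  negation and addition.\<close>

lemma equiv_homologous:
  assumes "chain_complex C"
  shows "equiv (cycles C n) (homologous C n)"
proof (rule equivI)
  note B = subspace_boundaries[OF assms, of n]
  show "homologous C n \<subseteq> cycles C n \<times> cycles C n"
    by (auto simp: homologous_def)
  show "refl_on (cycles C n) (homologous C n)"
    using B by (auto simp: homologous_def refl_on_def free_mod.subspace_0)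
  show "sym (homologous C n)"
    by (auto simp: homologous_def sym_def dest: free_mod.subspace_neg[OF B])
  show "trans (homologous C n)"
  proof (rule transI)
    fix x y z
    assume "(x, y) \<in> homologous C n" "(y, z) \<in> homologous C n"
    then show "(x, z) \<in> homologous C n"
      using free_mod.subspace_add[OF B, of "x - y" "y - z"] by (simp add: homologous_def)
  qed
qed

lemma homologous_add:
  assumes "chain_complex C" "(x, x') \<in> homologous C n" "(y, y') \<in> homologous C n"
  shows "(x + y, x' + y') \<in> homologous C n"
proof -
  have "x + y - (x' + y') \<in> boundaries C n"
    unfolding add_diff_add using assms(2,3)
    by (intro free_mod.subspace_add[OF subspace_boundaries[OF assms(1)]]) (simp_all add: homologous_def)
  moreover have "x + y \<in> cycles C n" "x' + y' \<in> cycles C n"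
    using assms(2,3)
    by (auto simp: homologous_def intro: free_mod.subspace_add[OF subspace_cycles[OF assms(1)]])
  ultimately show ?thesis
    by (simp add: homologous_def)
qed

lemma homologous_scale:
  assumes "chain_complex C" "(x, x') \<in> homologous C n"
  shows "(scale c x, scale c x') \<in> homologous C n"
proof -
  have "scale c x - scale c x' \<in> boundaries C n"
    unfolding free_mod.scale_right_diff_distrib[symmetric] using assms(2)
    by (intro free_mod.subspace_scale[OF subspace_boundaries[OF assms(1)]]) (simp add: homologous_def)
  moreover have "scale c x \<in> cycles C n" "scale c x' \<in> cycles C n"
    using assms(2)
    by (auto simp: homologous_def intro: free_mod.subspace_scale[OF subspace_cycles[OF assms(1)]])
  ultimately show ?thesis
    by (simp add: homologous_def)
qed

section \<open>Chain maps on homology\<close>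

lemma chain_map_cycles:
  assumes "chain_map C D \<phi>" "x \<in> cycles C n"
  shows "\<phi> n x \<in> cycles D n"
proof (cases n)
  \<comment> \<open>Commutation with the differential is stated for positive degrees; in degree 0
    every chain is a cycle.\<close>
  case 0
  have "submodule_hom (chains D 0) {0} (diff D 0)" "submodule_hom (chains C 0) (chains D 0) (\<phi> 0)"
    using assms(1) by (auto simp: chain_map_def chain_complex_def)
  with 0 assms(2) show ?thesis
    by (auto simp: cycles_def submodule_hom_def)
next
  case (Suc m)
  have "submodule_hom (chains C k) (chains D k) (\<phi> k)" "0 \<in> chains C k" for k
    using assms(1) by (auto simp: chain_map_def chain_complex_def free_mod.subspace_0)
  moreover from this have "\<phi> m 0 = 0"
    by (intro submodule_hom_0)
  moreover have "\<phi> m (diff C n x) = diff D n (\<phi> n x)"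
    using assms Suc unfolding chain_map_def cycles_def by blast
  moreover have "\<phi> n x \<in> chains D n"
    using calculation(1)[of n] assms(2) by (auto simp: cycles_def submodule_hom_def)
  ultimately show ?thesis
    using assms(2) by (simp add: cycles_def)
qed

text \<open>If \<open>x - y\<close> is the boundary of \<open>z\<close>, then
  \<open>\<phi> n x - \<phi> n y\<close> is the boundary of the image of \<open>z\<close>.\<close>

lemma chain_map_homologous:
  assumes "chain_map C D \<phi>" "(x, y) \<in> homologous C n"
  shows "(\<phi> n x, \<phi> n y) \<in> homologous D n"
proof -
  have C: "free_mod.subspace (chains C n)"
    and \<phi>: "submodule_hom (chains C k) (chains D k) (\<phi> k)" for k
    using assms(1) by (auto simp: chain_map_def chain_complex_def)
  have xy: "x \<in> cycles C n" "y \<in> cycles C n"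
    using assms(2) by (auto simp: homologous_def)
  obtain z where z: "z \<in> chains C (Suc n)" "x - y = diff C (Suc n) z"
    using assms(2) by (auto simp: homologous_def boundaries_def)
  have "\<phi> n x - \<phi> n y = \<phi> n (x - y)"
    using xy by (simp add: submodule_hom_diff[OF C \<phi>] cycles_def)
  also have "\<dots> = diff D (Suc n) (\<phi> (Suc n) z)"
    using assms(1) z by (simp add: chain_map_def)
  finally have "\<phi> n x - \<phi> n y \<in> boundaries D n"
    using z(1) \<phi>[of "Suc n"] by (auto simp: boundaries_def submodule_hom_def)
  then show ?thesis
    using xy by (simp add: homologous_def chain_map_cycles[OF assms(1)])
qed

lemma homology_add_class:
  assumes "chain_complex C" "x \<in> cycles C n" "y \<in> cycles C n"
  shows "homology_add C n (homologous C n `` {x}) (homologous C n `` {y}) = homologous C n `` {x + y}"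
proof -
  note eqv = equiv_homologous[OF assms(1), of n]
  \<comment> \<open>All pairs of representatives give the same class, so the union in
    \<open>homology_add\<close> collapses to that class.\<close>
  have "congruent2 (homologous C n) (homologous C n) (\<lambda>x y. homologous C n `` {x + y})"
    by (intro congruent2I' equiv_class_eq[OF eqv] homologous_add assms(1))
  then show ?thesis
    unfolding homology_add_def by (rule UN_equiv_class2[OF eqv eqv _ assms(2,3)])
qed

lemma homology_scale_class:
  assumes "chain_complex C" "x \<in> cycles C n"
  shows "homology_scale C n c (homologous C n `` {x}) = homologous C n `` {scale c x}"
proof -
  note eqv = equiv_homologous[OF assms(1), of n]
  have "(\<lambda>x. homologous C n `` {scale c x}) respects homologous C n"
    by (intro congruentI equiv_class_eq[OF eqv] homologous_scale assms(1))
  then show ?thesis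
    unfolding homology_scale_def by (rule UN_equiv_class[OF eqv _ assms(2)])
qed

lemma homology_map_class:
  assumes "chain_map C D \<phi>" "x \<in> cycles C n"
  shows "homology_map D n \<phi> (homologous C n `` {x}) = homologous D n `` {\<phi> n x}"
proof -
  have "chain_complex C" "chain_complex D"
    using assms(1) by (auto simp: chain_map_def)
  note eqv = this[THEN equiv_homologous, of n]
  have "(\<lambda>x. homologous D n `` {\<phi> n x}) respects homologous C n"
    by (intro congruentI equiv_class_eq[OF eqv(2)] chain_map_homologous[OF assms(1)])
  then show ?thesis
    unfolding homology_map_def by (rule UN_equiv_class[OF eqv(1) _ assms(2)])
qed

lemma homology_hom_homology_map:
  assumes "chain_map C D \<phi>"
  shows "homology_hom C D n (homology_map D n \<phi>)"
proof -
  have C: "chain_complex C" and D: "chain_complex D"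
    and \<phi>: "submodule_hom (chains C n) (chains D n) (\<phi> n)"
    using assms by (auto simp: chain_map_def)
  have add: "x + y \<in> cycles C n" "\<phi> n (x + y) = \<phi> n x + \<phi> n y"
    if "x \<in> cycles C n" "y \<in> cycles C n" for x y
  proof -
    show "x + y \<in> cycles C n"
      using that by (rule free_mod.subspace_add[OF subspace_cycles[OF C]])
    show "\<phi> n (x + y) = \<phi> n x + \<phi> n y"
      using that \<phi> unfolding cycles_def submodule_hom_def by blast
  qed
  have scale: "scale c x \<in> cycles C n" "\<phi> n (scale c x) = scale c (\<phi> n x)"
    if "x \<in> cycles C n" for c x
  proof -
    show "scale c x \<in> cycles C n"
      using that by (rule free_mod.subspace_scale[OF subspace_cycles[OF C]])
    show "\<phi> n (scale c x) = scale c (\<phi> n x)"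
      using that \<phi> unfolding cycles_def submodule_hom_def by blast
  qed
  let ?F = "homology_map D n \<phi>"
  note map_class = homology_map_class[OF assms] and map_cycles = chain_map_cycles[OF assms]
  show ?thesis
    unfolding homology_hom_def
  proof (intro conjI ballI allI image_subsetI)
    fix X assume "X \<in> homology C n"
    then obtain x where x: "x \<in> cycles C n" and X: "X = homologous C n `` {x}"
      unfolding homology_def by (rule quotientE)
    show "?F X \<in> homology D n"
      by (simp only: X map_class[OF x] homology_def quotientI[OF map_cycles[OF x]])
    show "?F (homology_scale C n c X) = homology_scale D n c (?F X)" for c
      by (simp only: X map_class[OF x] homology_scale_class[OF C x] map_class[OF scale(1)[OF x]]
          homology_scale_class[OF D map_cycles[OF x]] scale(2)[OF x])
    fix Y assume "Y \<in> homology C n"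
    then obtain y where y: "y \<in> cycles C n" and Y: "Y = homologous C n `` {y}"
      unfolding homology_def by (rule quotientE)
    show "?F (homology_add C n X Y) = homology_add D n (?F X) (?F Y)"
      by (simp only: X Y map_class[OF x] map_class[OF y] homology_add_class[OF C x y]
          map_class[OF add(1)[OF x y]] homology_add_class[OF D map_cycles[OF x] map_cycles[OF y]]
          add(2)[OF x y])
  qed
qed

text \<open>On a cycle \<open>x\<close> the homotopy formula loses its second term, so
  \<open>\<phi> n x\<close> and \<open>\<psi> n x\<close> differ by the boundary of
  \<open>s n x\<close>.\<close>

lemma homology_map_eq_if_chain_homotopic:
  assumes "chain_homotopic C D \<phi> \<psi>" "X \<in> homology C n"
  shows "homology_map D n \<phi> X = homology_map D n \<psi> X"
proof -
  obtain x where x: "x \<in> cycles C n" and X: "X = homologous C n `` {x}"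
    using assms(2) unfolding homology_def by (rule quotientE)
  have maps: "chain_map C D \<phi>" "chain_map C D \<psi>"
    using assms(1) unfolding chain_homotopic_def by blast+
  obtain s where s: "\<And>n. submodule_hom (chains C n) (chains D (Suc n)) (s n)"
    and s_eq: "\<And>n x. x \<in> chains C n \<Longrightarrow>
      \<phi> n x - \<psi> n x = diff D (Suc n) (s n x) + (case n of 0 \<Rightarrow> 0 | Suc m \<Rightarrow> s m (diff C n x))"
    using assms(1) unfolding chain_homotopic_def by blast
  have s_0: "s m 0 = 0" for m
  proof (rule submodule_hom_0[OF s])
    show "0 \<in> chains C m"
      using maps(1) unfolding chain_map_def chain_complex_def by (blast intro: free_mod.subspace_0)
  qed
  have "x \<in> chains C n" "diff C n x = 0"
    using x by (auto simp: cycles_def)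
  then have "\<phi> n x - \<psi> n x = diff D (Suc n) (s n x)"
    using s_eq[of x n] by (cases n) (simp_all add: s_0)
  moreover have "s n x \<in> chains D (Suc n)"
    using s[of n] \<open>x \<in> chains C n\<close> unfolding submodule_hom_def by blast
  ultimately have "(\<phi> n x, \<psi> n x) \<in> homologous D n"
    using chain_map_cycles[OF maps(1) x] chain_map_cycles[OF maps(2) x]
    by (simp add: homologous_def boundaries_def)
  then have "homologous D n `` {\<phi> n x} = homologous D n `` {\<psi> n x}"
    using maps(1) unfolding chain_map_def by (intro equiv_class_eq[OF equiv_homologous]) simp_all
  then show ?thesis
    by (simp add: X homology_map_class[OF maps(1) x] homology_map_class[OF maps(2) x])
qed

theorem theorem2p6:
  fixes K :: "('a, 'r::comm_ring_1) wpath_complex"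
    and L :: "('b, 'r) wpath_complex"
    and f g :: "'a \<Rightarrow> 'b"
  assumes "weighted_path_complex K"
    and "weighted_path_complex L"
    and "\<forall>i \<in> verts K. weight K i dvd 1"
    and "weighted_morphism K L f"
    and "weighted_morphism K L g"
    and "homotopic K L f g"
  shows "chain_homotopic (Omega K) (Omega L) (induced f) (induced g) \<and>
         (\<forall>n. homology_hom (Omega K) (Omega L) n (homology_map (Omega L) n (induced f)) \<and>
              homology_hom (Omega K) (Omega L) n (homology_map (Omega L) n (induced g)) \<and>
              (\<forall>X \<in> homology (Omega K) n.
                 homology_map (Omega L) n (induced f) X = homology_map (Omega L) n (induced g) X))"
proof -
  note htpy = chain_homotopic_if_homotopic[OF assms(1,3-6)]
  note maps = chain_map_induced[OF assms(1,4)] chain_map_induced[OF assms(1,5)]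
  show ?thesis
  proof (intro conjI allI ballI)
    show "chain_homotopic (Omega K) (Omega L) (induced f) (induced g)"
      by (rule htpy)
    show "homology_hom (Omega K) (Omega L) n (homology_map (Omega L) n (induced f))" for n
      by (rule homology_hom_homology_map[OF maps(1)])
    show "homology_hom (Omega K) (Omega L) n (homology_map (Omega L) n (induced g))" for n
      by (rule homology_hom_homology_map[OF maps(2)])
    show "homology_map (Omega L) n (induced f) X = homology_map (Omega L) n (induced g) X"
      if "X \<in> homology (Omega K) n" for n X
      using htpy that by (rule homology_map_eq_if_chain_homotopic)
  qed
qed

end
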